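(* Let $p\equiv 1\pmod 4$ be a prime and $L_p=(p-1)(p-5)/96$. Let $X=\{(a,b)\in V\times V : a<b<\overline{a}<\overline{b}\}$, $Y=\{(a,b)\in V\times V : a<\overline{a}<b<\overline{b}\}$, $Z=\{(a,b)\in V\times V : a<b<\overline{b}<\overline{a}\}$. Then $|Y|=L_p$ and $|X|+|Z|=2L_p$.
   Context: For an integer $x$, $\{x\}_p$ denotes the least nonnegative residue of $x$ modulo $p$, and $\widetilde{x}=p-\{x\}_p$ if $\{x\}_p>p/2$, while $\widetilde{x}=\{x\}_p$ if $\{x\}_p<p/2$. Let $t=\prod_{x=1}^{(p-1)/2}x$. Let $V=\{x : 1\le x\le (p-1)/2,\ x<\widetilde{tx}\}$, and for $a\in V$ put $\overline{a}=\widetilde{ta}$. *)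

theory Defs
  imports Complex_Main "HOL-Number_Theory.Number_Theory"
begin

text \<open>
  The tie \<open>x mod p = p / 2\<close> cannot occur for odd \<open>p\<close>, so a single conditional covers both cases.
\<close>

definition tilde :: "int \<Rightarrow> int \<Rightarrow> int" where
  "tilde p x = (if real_of_int (x mod p) > real_of_int p / 2 then p - x mod p else x mod p)"

definition half_fact :: "int \<Rightarrow> int" where
  "half_fact p = (\<Prod>x\<in>{1..(p - 1) div 2}. x)"

definition bar :: "int \<Rightarrow> int \<Rightarrow> int" where
  "bar p a = tilde p (half_fact p * a)"

definition V_set :: "int \<Rightarrow> int set" where
  "V_set p = {x. 1 \<le> x \<and> x \<le> (p - 1) div 2 \<and> x < tilde p (half_fact p * x)}"

definition X_set :: "int \<Rightarrow> (int \<times> int) set" where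
  "X_set p = {(a, b) \<in> V_set p \<times> V_set p. a < b \<and> b < bar p a \<and> bar p a < bar p b}"

definition Y_set :: "int \<Rightarrow> (int \<times> int) set" where
  "Y_set p = {(a, b) \<in> V_set p \<times> V_set p. a < bar p a \<and> bar p a < b \<and> b < bar p b}"

definition Z_set :: "int \<Rightarrow> (int \<times> int) set" where
  "Z_set p = {(a, b) \<in> V_set p \<times> V_set p. a < b \<and> b < bar p b \<and> bar p b < bar p a}"

definition L :: "int \<Rightarrow> real" where
  "L p = (real_of_int p - 1) * (real_of_int p - 5) / 96"

end

theory Submission
  imports Defs
begin

text \<open>
  Put \<open>n = (p - 1) div 2\<close> and \<open>t = half_fact p\<close>. By Wilson's theorem \<open>t\<^sup>2 \<equiv> -1\<close>, so \<open>bar p\<close> is a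
  fixed-point-free involution of \<open>{1..n}\<close>; regard its orbits as \<open>n div 2\<close> chords \<open>{a, bar p a}\<close>.
  All pairs of chords are counted by \<open>X\<close>, \<open>Y\<close> and \<open>Z\<close> together, while the number of points lying
  strictly inside the chords is \<open>2 * (|X| + |Z|)\<close>. Hence only the sum \<open>D\<close> of
  \<open>\<bar>bar p x - x\<bar>\<close> over all \<open>x\<close> is needed.

  Up to sign, \<open>bar p x - x\<close> and \<open>bar p x + x\<close> are congruent to \<open>(t - 1) * x\<close> and \<open>(t + 1) * x\<close> in
  some order. So \<open>\<bar>bar p x - x\<bar>\<close> and \<open>tilde p (bar p x + x)\<close> together run twice through \<open>{1..n}\<close>.
  Write \<open>s = bar p x + x\<close>, so that \<open>s\<^sup>2 - (tilde p s)\<^sup>2 = p * (s - tilde p s)\<close>. Comparing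
  sums of first powers gives \<open>D = \<Sum>(s - tilde p s)\<close>, and comparing sums of squares gives
  \<open>p * \<Sum>(s - tilde p s) = 2 * (1\<^sup>2 + \<dots> + n\<^sup>2)\<close>. Therefore \<open>3 * D = n * (n + 1)\<close>.
\<close>

section \<open>Chords of a fixed-point-free involution\<close>

locale fixpoint_free_involution =
  fixes n :: int and s :: "int \<Rightarrow> int"
  assumes n_nonneg: "0 \<le> n"
    and in_range: "x \<in> {1..n} \<Longrightarrow> s x \<in> {1..n}"
    and involution: "x \<in> {1..n} \<Longrightarrow> s (s x) = x"
    and fixpoint_free: "x \<in> {1..n} \<Longrightarrow> s x \<noteq> x"
begin

definition V :: "int set" where
  "V = {x \<in> {1..n}. x < s x}"

definition X :: "(int \<times> int) set" where
  "X = {(a, b) \<in> V \<times> V. a < b \<and> b < s a \<and> s a < s b}"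

definition Y :: "(int \<times> int) set" where
  "Y = {(a, b) \<in> V \<times> V. a < s a \<and> s a < b \<and> b < s b}"

definition Z :: "(int \<times> int) set" where
  "Z = {(a, b) \<in> V \<times> V. a < b \<and> b < s b \<and> s b < s a}"

lemma finite_V [simp]: "finite V"
  unfolding V_def by (rule finite_subset[of _ "{1..n}"]) auto

lemma finite_X [simp]: "finite X" and finite_Y [simp]: "finite Y" and finite_Z [simp]: "finite Z"
proof -
  have "X \<subseteq> V \<times> V" "Y \<subseteq> V \<times> V" "Z \<subseteq> V \<times> V" by (auto simp: X_def Y_def Z_def)
  then show "finite X" "finite Y" "finite Z" by (simp_all add: finite_subset[of _ "V \<times> V"])
qed

lemma inj_on_s: "inj_on s {1..n}"
  by (metis inj_onI involution)

lemma range_split: "{1..n} = V \<union> s ` V"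
proof (intro equalityI subsetI)
  fix x assume x: "x \<in> {1..n}"
  show "x \<in> V \<union> s ` V"
  proof (cases "x < s x")
    case False
    then have "s x \<in> V"
      using x fixpoint_free[OF x] involution[OF x] in_range[OF x] by (auto simp: V_def)
    then show ?thesis using involution[OF x] by (metis UnCI image_eqI)
  qed (use x in \<open>auto simp: V_def\<close>)
qed (use in_range in \<open>auto simp: V_def\<close>)

lemma V_inter_image: "V \<inter> s ` V = {}"
  using involution by (force simp: V_def)

lemma sum_range_split:
  fixes f :: "int \<Rightarrow> 'b::comm_monoid_add"
  shows "(\<Sum>x\<in>{1..n}. f x) = (\<Sum>a\<in>V. f a + f (s a))"
proof -
  have "inj_on s V" using inj_on_s by (rule inj_on_subset) (auto simp: V_def)
  then show ?thesis
    by (subst range_split, subst sum.union_disjoint)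
      (auto simp: V_inter_image sum.reindex sum.distrib)
qed

lemma card_V: "2 * int (card V) = n"
  using sum_range_split[of "\<lambda>_. 1 :: int"] n_nonneg by simp

lemma sum_length: "(\<Sum>x\<in>{1..n}. \<bar>s x - x\<bar>) = 2 * (\<Sum>a\<in>V. s a - a)"
  unfolding sum_range_split sum_distrib_left
  by (rule sum.cong) (use involution in \<open>auto simp: V_def\<close>)

text \<open>Distinct chords share no endpoint, so two of them, ordered by left endpoint, cross, are
  separate or are nested. Adjoining the swapped pairs gives \<open>V \<times> V\<close> without its
  diagonal.\<close>

lemma card_pairs: "2 * (card X + card Y + card Z) = card V * (card V - 1)"
proof -
  let ?P = "{(a, b) \<in> V \<times> V. a < b}"
  have s_neq: "s a \<noteq> b \<and> (a \<noteq> b \<longrightarrow> s a \<noteq> s b)" if "a \<in> V" "b \<in> V" for a b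
    using that V_inter_image inj_on_s by (auto simp: V_def inj_on_def)
  have P: "?P = X \<union> Y \<union> Z"
  proof (intro equalityI subrelI)
    fix a b assume "(a, b) \<in> ?P"
    then have ab: "a \<in> V" "b \<in> V" "a < b" by auto
    then have "a < s a" "b < s b" "s a \<noteq> b" "s a \<noteq> s b" using s_neq by (auto simp: V_def)
    with ab show "(a, b) \<in> X \<union> Y \<union> Z" by (auto simp: X_def Y_def Z_def)
  qed (auto simp: X_def Y_def Z_def)
  have fin: "finite ?P" using P by simp
  have cP: "card ?P = card X + card Y + card Z"
  proof -
    have "X \<inter> Y = {}" "(X \<union> Y) \<inter> Z = {}" by (auto simp: X_def Y_def Z_def)
    then show ?thesis unfolding P by (simp add: card_Un_disjoint)
  qed
  have "V \<times> V - Id_on V = ?P \<union> prod.swap ` ?P" by (auto simp: image_iff Id_on_iff)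
  moreover have "card (?P \<union> prod.swap ` ?P) = card ?P + card (prod.swap ` ?P)"
    by (rule card_Un_disjoint) (use fin in auto)
  moreover have "card (prod.swap ` ?P) = card ?P"
    by (rule card_image) (auto simp: inj_on_def)
  moreover have "card (V \<times> V - Id_on V) = card (V \<times> V) - card V"
  proof -
    have "Id_on V = (\<lambda>x. (x, x)) ` V" by auto
    then have "card (Id_on V) = card V" by (simp add: card_image inj_on_def)
    moreover have "finite (Id_on V)" "Id_on V \<subseteq> V \<times> V" by (auto simp: Id_on_def)
    ultimately show ?thesis by (simp add: card_Diff_subset)
  qed
  ultimately show ?thesis using cP by (simp add: card_cartesian_product diff_mult_distrib2)
qed

text \<open>Each pair of crossing or nested chords produces exactly two incidences of an endpoint of one
  chord lying strictly inside the other.\<close>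

lemma sum_interior: "(\<Sum>a\<in>V. s a - a - 1) = 2 * int (card X + card Z)"
proof -
  let ?P = "Sigma V (\<lambda>a. {a<..<s a})"
  \<comment> \<open>An interior point of chord \<open>a\<close> that is a left endpoint gives a pair
    in \<open>X\<close> or \<open>Z\<close> directly. A right endpoint \<open>s b\<close> comes from
    a nested pair \<open>(a, b)\<close> by \<open>?f\<close> or from a crossing pair
    \<open>(b, a)\<close> by \<open>?g\<close>.\<close>
  let ?f = "\<lambda>(a, b). (a, s b)" and ?g = "\<lambda>(a, b). (b, s a)"
  have P: "?P = (X \<union> Z) \<union> (?f ` Z \<union> ?g ` X)"
  proof (intro equalityI subrelI)
    fix a x assume "(a, x) \<in> ?P"
    then have a: "a \<in> V" and x: "a < x" "x < s a" by auto
    have a': "a \<in> {1..n}" "s a \<in> {1..n}" using a in_range by (auto simp: V_def)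
    then have "x \<in> {1..n}" using x by auto
    then consider "x \<in> V" | b where "b \<in> V" "x = s b" using range_split by blast
    then show "(a, x) \<in> (X \<union> Z) \<union> (?f ` Z \<union> ?g ` X)"
    proof cases
      case 1
      then have "s x \<noteq> s a" using inj_on_eq_iff[OF inj_on_s, of x a] a x by (auto simp: V_def)
      with 1 a x show ?thesis by (auto simp: X_def Z_def V_def)
    next
      case (2 b)
      then have "a \<noteq> b" using x by auto
      then have "(a, b) \<in> Z \<or> (b, a) \<in> X" using 2 a x by (auto simp: X_def Z_def V_def)
      then show ?thesis using 2 by force
    qed
  qed (auto simp: X_def Z_def V_def)
  have X_Z: "X \<inter> Z = {}" by (auto simp: X_def Z_def)
  have f_g: "?f ` Z \<inter> ?g ` X = {}"
  proof -
    have False if "(a, b) \<in> Z" "(c, a) \<in> X" "s b = s c" for a b c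
      using that inj_on_eq_iff[OF inj_on_s, of b c] by (auto simp: X_def Z_def V_def)
    then show ?thesis by auto
  qed
  \<comment> \<open>Second components are left endpoints on one side and right endpoints on the
    other.\<close>
  have disj: "(X \<union> Z) \<inter> (?f ` Z \<union> ?g ` X) = {}"
    using V_inter_image by (auto simp: X_def Z_def)
  have inj_f: "inj_on ?f Z" and inj_g: "inj_on ?g X"
    using inj_on_s by (auto simp: inj_on_def X_def Z_def V_def)
  have "card ?P = (card X + card Z) + (card (?f ` Z) + card (?g ` X))"
    unfolding P using disj X_Z f_g by (simp add: card_Un_disjoint)
  then have "int (card ?P) = 2 * int (card X + card Z)"
    using card_image[OF inj_f] card_image[OF inj_g] by simp
  moreover have "int (card ?P) = (\<Sum>a\<in>V. s a - a - 1)"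
    using finite_V by (subst card_SigmaI) (auto simp: V_def intro!: sum.cong)
  ultimately show ?thesis by simp
qed

text \<open>The sum over all points meets each chord twice, and each of the \<open>n div 2\<close>
  chords has one interior point fewer than its length.\<close>

lemma card_X_Z: "4 * int (card X + card Z) = (\<Sum>x\<in>{1..n}. \<bar>s x - x\<bar>) - n"
  using sum_length sum_interior card_V by (simp add: sum_subtractf)

end

section \<open>Absolute least residues\<close>

lemma dvd_small_eq_0: "p dvd x \<Longrightarrow> \<bar>x\<bar> < p \<Longrightarrow> x = 0" for p x :: int
  using dvd_imp_le_int[of x p] by auto

text \<open>The disjunction is congruence modulo \<open>p\<close> up to sign. Symmetry here and
  transitivity below let such congruences be chained without tracking signs.\<close>

lemma dvd_plus_minus_sym:
  fixes p x y :: int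
  assumes "p dvd x - y \<or> p dvd x + y"
  shows "p dvd y - x \<or> p dvd y + x"
  using assms by (simp add: dvd_diff_commute add.commute)

lemma dvd_plus_minus_trans:
  fixes p x y z :: int
  assumes "p dvd x - y \<or> p dvd x + y" and "p dvd y - z \<or> p dvd y + z"
  shows "p dvd x - z \<or> p dvd x + z"
  using assms
proof (elim disjE)
  assume "p dvd x - y" "p dvd y - z"
  from dvd_add[OF this] show ?thesis by simp
next
  assume "p dvd x - y" "p dvd y + z"
  from dvd_add[OF this] show ?thesis by simp
next
  assume "p dvd x + y" "p dvd y - z"
  from dvd_diff[OF this] show ?thesis by simp
next
  assume "p dvd x + y" "p dvd y + z"
  from dvd_diff[OF this] show ?thesis by simp
qed

lemma tilde_eq_if: "tilde p x = (if 2 * (x mod p) > p then p - x mod p else x mod p)"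
proof -
  have "real_of_int (x mod p) > real_of_int p / 2 \<longleftrightarrow> 2 * (x mod p) > p" by linarith
  then show ?thesis by (simp add: tilde_def)
qed

lemma tilde_nonneg: "0 < p \<Longrightarrow> 0 \<le> tilde p x"
  by (auto simp: tilde_eq_if order_less_imp_le)

lemma tilde_le: "0 < p \<Longrightarrow> 2 * tilde p x \<le> p"
  by (auto simp: tilde_eq_if)

lemma tilde_dvd: "p dvd tilde p x - x \<or> p dvd tilde p x + x"
proof -
  have "x = p * (x div p) + x mod p" by simp
  then have "x mod p - x = p * - (x div p)" "p - x mod p + x = p * (x div p + 1)"
    by (auto simp: algebra_simps)
  then show ?thesis unfolding tilde_eq_if by (metis dvd_triv_left)
qed

context
  fixes p :: int
  assumes odd_p: "odd p" and p_pos: "0 < p"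
begin

lemma tilde_range: "tilde p x \<in> {0..(p - 1) div 2}"
  using tilde_nonneg[OF p_pos, of x] tilde_le[OF p_pos, of x] odd_p by (auto elim!: oddE)

text \<open>Two candidates in the range are congruent up to sign, and both their difference and
  their sum are below \<open>p\<close> in absolute value, so one of these is 0.\<close>

lemma tilde_eqI:
  assumes "y \<in> {0..(p - 1) div 2}" and "p dvd y - x \<or> p dvd y + x"
  shows "tilde p x = y"
proof -
  let ?z = "tilde p x"
  have z: "?z \<in> {0..(p - 1) div 2}" by (rule tilde_range)
  have "p dvd ?z - y \<or> p dvd ?z + y"
    using tilde_dvd dvd_plus_minus_sym[OF assms(2)] by (rule dvd_plus_minus_trans)
  moreover have "\<bar>?z - y\<bar> < p" "\<bar>?z + y\<bar> < p"
    using z assms(1) p_pos by auto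
  ultimately have "?z - y = 0 \<or> ?z + y = 0" using dvd_small_eq_0 by blast
  then show ?thesis using z assms(1) by auto
qed

lemma tilde_cong: "p dvd x - y \<or> p dvd x + y \<Longrightarrow> tilde p x = tilde p y"
  by (rule tilde_eqI[OF tilde_range dvd_plus_minus_trans[OF tilde_dvd dvd_plus_minus_sym]])

text \<open>Either \<open>tilde p x\<close> is \<open>x\<close> and both sides vanish, or it is
  \<open>p - x\<close> and both sides are \<open>p * (2 * x - p)\<close>.\<close>

lemma square_diff_tilde:
  assumes "0 \<le> x" "x < p"
  shows "x\<^sup>2 - (tilde p x)\<^sup>2 = p * (x - tilde p x)"
  using assms by (auto simp: tilde_eq_if power2_eq_square algebra_simps)

lemma not_dvd_range: "x \<in> {1..(p - 1) div 2} \<Longrightarrow> \<not> p dvd x"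
  using p_pos by (auto dest!: zdvd_imp_le)

text \<open>This is the permutation behind Gauss's lemma: the range represents the nonzero residues
  up to sign, and multiplication by a unit permutes these classes.\<close>

lemma bij_betw_tilde_mult:
  assumes "prime p" and "\<not> p dvd c"
  shows "bij_betw (\<lambda>x. tilde p (c * x)) {1..(p - 1) div 2} {1..(p - 1) div 2}"
proof -
  let ?H = "{1..(p - 1) div 2}" and ?f = "\<lambda>x. tilde p (c * x)"
  have "?f x \<in> ?H" if "x \<in> ?H" for x
  proof -
    have "\<not> p dvd c * x"
      using assms not_dvd_range[OF that] by (simp add: prime_dvd_mult_iff)
    then have "?f x \<noteq> 0" using tilde_dvd[of p "c * x"] by auto
    then show ?thesis using tilde_range[of "c * x"] by auto
  qed
  then have into: "?f ` ?H \<subseteq> ?H" by blast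
  have inj: "inj_on ?f ?H"
  proof (rule inj_onI)
    fix x y assume x: "x \<in> ?H" and y: "y \<in> ?H" and eq: "?f x = ?f y"
    have "p dvd c * x - c * y \<or> p dvd c * x + c * y"
      using dvd_plus_minus_sym[OF tilde_dvd] tilde_dvd[of p "c * y", folded eq]
      by (rule dvd_plus_minus_trans)
    then have "p dvd c * (x - y) \<or> p dvd c * (x + y)" by (simp add: algebra_simps)
    then have "p dvd x - y \<or> p dvd x + y" using assms by (simp add: prime_dvd_mult_iff)
    moreover have "\<bar>x - y\<bar> < p" "\<bar>x + y\<bar> < p" using x y p_pos by auto
    ultimately have "x - y = 0 \<or> x + y = 0" using dvd_small_eq_0 by blast
    then show "x = y" using x y by auto
  qed
  show ?thesis using inj endo_inj_surj[OF _ into inj] by (simp add: bij_betw_def)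
qed

end

section \<open>The square of the half factorial\<close>

text \<open>In Wilson's product the upper half consists of the factors \<open>p - x\<close>,
  congruent to \<open>- x\<close>, for \<open>x\<close> in the lower half.\<close>

lemma half_fact_square:
  assumes "prime p" and "[p = 1] (mod 4)"
  shows "p dvd (half_fact p)\<^sup>2 + 1"
proof -
  let ?n = "(p - 1) div 2"
  from assms have "4 dvd p - 1" by (simp add: cong_iff_dvd_diff)
  then obtain k where k: "p - 1 = 4 * k" by (elim dvdE)
  then have n: "?n = 2 * k" and p: "p = 4 * k + 1" by auto
  have p1: "p > 1" using assms(1) by (rule prime_gt_1_int)
  then have kpos: "k > 0" using p by simp
  have "prime (nat p)" using assms(1) prime_int_nat_transfer by blast
  then have "[fact (nat p - 1) = (-1::int)] (mod p)"
    using wilson_theorem[of "nat p"] p1 by simp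
  moreover have "(fact (nat p - 1) :: int) = (\<Prod>x\<in>{1..p - 1}. x)"
  proof -
    have "(fact (nat p - 1) :: int) = (\<Prod>i\<in>{1..nat p - 1}. int i)"
      by (simp add: fact_prod)
    also have "\<dots> = (\<Prod>x\<in>{1..p - 1}. x)"
      by (rule prod.reindex_bij_witness[of _ nat int]) (use p1 in auto)
    finally show ?thesis .
  qed
  moreover have "(\<Prod>x\<in>{1..p - 1}. x) = half_fact p * (\<Prod>x\<in>{1..?n}. p - x)"
  proof -
    have "{1..p - 1} = {1..?n} \<union> {?n + 1..p - 1}" using n p kpos by auto
    moreover have "(\<Prod>x\<in>{?n + 1..p - 1}. x) = (\<Prod>x\<in>{1..?n}. p - x)"
      by (rule prod.reindex_bij_witness[of _ "\<lambda>x. p - x" "\<lambda>x. p - x"]) (use n p kpos in auto)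
    moreover have "{1..?n} \<inter> {?n + 1..p - 1} = {}" by auto
    ultimately show ?thesis
      unfolding half_fact_def by (simp only: prod.union_disjoint finite_atLeastAtMost_int)
  qed
  moreover have "[(\<Prod>x\<in>{1..?n}. p - x) = half_fact p] (mod p)"
  proof -
    have "[(\<Prod>x\<in>{1..?n}. p - x) = (\<Prod>x\<in>{1..?n}. - x)] (mod p)"
      by (rule cong_prod) (simp add: cong_iff_dvd_diff)
    \<comment> \<open>The signs cancel because their number \<open>?n = 2 * k\<close> is even; this
      is where the congruence modulo 4 enters.\<close>
    moreover have "(\<Prod>x\<in>{1..?n}. - x) = half_fact p"
      using kpos by (simp add: half_fact_def n prod_uminus nat_mult_distrib)
    ultimately show ?thesis by simp
  qed
  ultimately have "[half_fact p * half_fact p = -1] (mod p)"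
    using cong_scalar_left[of "\<Prod>x\<in>{1..?n}. p - x" "half_fact p" p "half_fact p"]
    by (metis cong_sym cong_trans)
  then show ?thesis by (simp add: cong_iff_dvd_diff power2_eq_square)
qed

section \<open>The total length of the chords\<close>

lemma sum_squares_int_upto:
  fixes n :: int
  assumes "0 \<le> n"
  shows "6 * (\<Sum>x\<in>{1..n}. x\<^sup>2) = n * (n + 1) * (2 * n + 1)"
  using assms
proof (induction n rule: int_ge_induct)
  case (step i)
  have "{1..i + 1} = insert (i + 1) {1..i}" using step.hyps by auto
  then show ?case using step.IH by (simp add: algebra_simps power2_eq_square)
qed simp

context
  fixes p :: int
  assumes prime_p: "prime p" and p_cong: "[p = 1] (mod 4)"
begin

lemma p_form: "odd p" "0 < p" "2 < p" "0 \<le> (p - 1) div 2" "p = 2 * ((p - 1) div 2) + 1"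
proof -
  have "p > 1" using prime_p by (rule prime_gt_1_int)
  moreover have "4 dvd p - 1" using p_cong by (simp add: cong_iff_dvd_diff)
  ultimately show "odd p" "0 < p" "2 < p" "0 \<le> (p - 1) div 2" "p = 2 * ((p - 1) div 2) + 1"
    by presburger+
qed

text \<open>Makes multiplication by \<open>t\<close>, \<open>t - 1\<close> and \<open>t + 1\<close>
  invertible modulo \<open>p\<close>. Given \<open>p dvd t\<^sup>2 + 1\<close>, a failure would
  force \<open>p dvd 1\<close> or \<open>p dvd 2\<close>.\<close>

lemma half_fact_not_dvd:
  "\<not> p dvd half_fact p" "\<not> p dvd half_fact p - 1" "\<not> p dvd half_fact p + 1"
proof -
  let ?t = "half_fact p"
  have sq: "p dvd ?t\<^sup>2 + 1" by (rule half_fact_square[OF prime_p p_cong])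
  have "\<not> p dvd 1" "\<not> p dvd 2" using p_form by (auto dest: zdvd_imp_le)
  moreover have "p dvd 1" if "p dvd ?t"
  proof -
    have "p dvd ?t\<^sup>2" using that by (simp add: power2_eq_square)
    then show ?thesis using sq dvd_add_right_iff by blast
  qed
  moreover have "p dvd 2" if "p dvd (?t - 1) * (?t + 1)"
  proof -
    have "(?t\<^sup>2 + 1) - (?t - 1) * (?t + 1) = 2" by (simp add: power2_eq_square algebra_simps)
    then show ?thesis using dvd_diff[OF sq that] by (simp only:)
  qed
  ultimately show "\<not> p dvd ?t" "\<not> p dvd ?t - 1" "\<not> p dvd ?t + 1"
    by (meson dvd_mult dvd_mult2)+
qed

lemma bij_betw_bar: "bij_betw (bar p) {1..(p - 1) div 2} {1..(p - 1) div 2}"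
  using bij_betw_tilde_mult[OF p_form(1,2) prime_p half_fact_not_dvd(1)]
  unfolding bar_def[abs_def] .

lemma bar_involution: "fixpoint_free_involution ((p - 1) div 2) (bar p)"
proof
  let ?t = "half_fact p"
  show "0 \<le> (p - 1) div 2" by (rule p_form)
  fix x assume x: "x \<in> {1..(p - 1) div 2}"
  show "bar p x \<in> {1..(p - 1) div 2}" using bij_betw_bar x by (rule bij_betw_apply)
  \<comment> \<open>Adding or subtracting \<open>t\<close> times the relation in
    \<open>bar_x\<close> cancels the term with \<open>t\<^sup>2\<close>.\<close>
  have sq: "p dvd (?t\<^sup>2 + 1) * x"
    using half_fact_square[OF prime_p p_cong] by (rule dvd_mult2)
  have bar_x: "p dvd bar p x - ?t * x \<or> p dvd bar p x + ?t * x"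
    unfolding bar_def by (rule tilde_dvd)
  show "bar p (bar p x) = x"
    unfolding bar_def[of p "bar p x"]
  proof (rule tilde_eqI[OF p_form(1,2)])
    show "x \<in> {0..(p - 1) div 2}" using x by auto
    show "p dvd x - ?t * bar p x \<or> p dvd x + ?t * bar p x"
      using bar_x
    proof
      assume "p dvd bar p x - ?t * x"
      from dvd_add[OF sq dvd_mult[OF this, of ?t]] show ?thesis
        by (simp add: algebra_simps power2_eq_square)
    next
      assume "p dvd bar p x + ?t * x"
      from dvd_diff[OF sq dvd_mult[OF this, of ?t]] show ?thesis
        by (simp add: algebra_simps power2_eq_square)
    qed
  qed
  show "bar p x \<noteq> x"
  proof
    assume "bar p x = x"
    with bar_x have "p dvd (?t - 1) * x \<or> p dvd (?t + 1) * x"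
      by (auto simp: algebra_simps dvd_diff_commute)
    then show False
      using prime_p half_fact_not_dvd not_dvd_range[OF p_form(1,2) x]
      by (simp add: prime_dvd_mult_iff)
  qed
qed

text \<open>Which of \<open>t - 1\<close> and \<open>t + 1\<close> belongs to the difference varies
  with \<open>x\<close>, but the summand is symmetric in the two. \<open>f\<close> stays general to
  serve for both the identity and squaring.\<close>

lemma sum_length_residues:
  fixes f :: "int \<Rightarrow> int"
  shows "(\<Sum>x\<in>{1..(p - 1) div 2}. f \<bar>bar p x - x\<bar> + f (tilde p (bar p x + x)))
    = 2 * (\<Sum>x\<in>{1..(p - 1) div 2}. f x)"
proof -
  let ?t = "half_fact p" and ?H = "{1..(p - 1) div 2}"
  have "f \<bar>bar p x - x\<bar> + f (tilde p (bar p x + x))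
      = f (tilde p ((?t - 1) * x)) + f (tilde p ((?t + 1) * x))" if x: "x \<in> ?H" for x
  proof -
    have "bar p x \<in> ?H" using bij_betw_bar x by (rule bij_betw_apply)
    \<comment> \<open>A difference of two points of the range is already reduced up to sign; their
      sum may exceed \<open>p / 2\<close> and keeps its \<open>tilde\<close>.\<close>
    then have "tilde p (bar p x - x) = \<bar>bar p x - x\<bar>"
      by (intro tilde_eqI[OF p_form(1,2)]) (use x in \<open>auto simp: abs_if\<close>)
    moreover have "p dvd bar p x - ?t * x \<or> p dvd bar p x + ?t * x"
      unfolding bar_def by (rule tilde_dvd)
    then have "tilde p (bar p x - x) = tilde p ((?t - 1) * x) \<and>
        tilde p (bar p x + x) = tilde p ((?t + 1) * x) \<or>
        tilde p (bar p x - x) = tilde p ((?t + 1) * x) \<and>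
        tilde p (bar p x + x) = tilde p ((?t - 1) * x)"
    proof (elim disjE)
      assume "p dvd bar p x - ?t * x"
      then show ?thesis
        by (intro disjI1 conjI; intro tilde_cong[OF p_form(1,2)] disjI1)
          (simp_all add: algebra_simps)
    next
      assume "p dvd bar p x + ?t * x"
      then show ?thesis
        by (intro disjI2 conjI; intro tilde_cong[OF p_form(1,2)] disjI2)
          (simp_all add: algebra_simps)
    qed
    ultimately show ?thesis by auto
  qed
  then have "(\<Sum>x\<in>?H. f \<bar>bar p x - x\<bar> + f (tilde p (bar p x + x)))
      = (\<Sum>x\<in>?H. f (tilde p ((?t - 1) * x))) + (\<Sum>x\<in>?H. f (tilde p ((?t + 1) * x)))"
    by (simp add: sum.distrib)
  also have "\<dots> = (\<Sum>x\<in>?H. f x) + (\<Sum>x\<in>?H. f x)"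
    using half_fact_not_dvd
    by (intro arg_cong2[where f = "(+)"] sum.reindex_bij_betw
        bij_betw_tilde_mult[OF p_form(1,2) prime_p])
  finally show ?thesis by simp
qed

lemma sum_length_bar:
  fixes n defines "n \<equiv> (p - 1) div 2"
  shows "3 * (\<Sum>x\<in>{1..n}. \<bar>bar p x - x\<bar>) = n * (n + 1)"
proof -
  let ?d = "\<lambda>x. \<bar>bar p x - x\<bar>" and ?s = "\<lambda>x. bar p x + x" and ?v = "\<lambda>x. tilde p (bar p x + x)"
  let ?S1 = "\<Sum>x\<in>{1..n}. x" and ?S2 = "\<Sum>x\<in>{1..n}. x\<^sup>2"
  have p: "p = 2 * n + 1" unfolding n_def by (rule p_form)
  have bij: "bij_betw (bar p) {1..n} {1..n}" unfolding n_def by (rule bij_betw_bar)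
  have bar_sum: "(\<Sum>x\<in>{1..n}. f (bar p x)) = (\<Sum>x\<in>{1..n}. f x)" for f :: "int \<Rightarrow> int"
    using bij by (rule sum.reindex_bij_betw)
  have d1: "(\<Sum>x\<in>{1..n}. ?d x) + (\<Sum>x\<in>{1..n}. ?v x) = 2 * ?S1"
    using sum_length_residues[of "\<lambda>x. x"] by (simp add: sum.distrib n_def)
  have s1: "(\<Sum>x\<in>{1..n}. ?s x) = 2 * ?S1"
    using bar_sum[of "\<lambda>x. x"] by (simp add: sum.distrib)
  have d2: "(\<Sum>x\<in>{1..n}. (?d x)\<^sup>2) + (\<Sum>x\<in>{1..n}. (?v x)\<^sup>2) = 2 * ?S2"
    using sum_length_residues[of "\<lambda>x. x\<^sup>2"] by (simp add: sum.distrib n_def)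
  \<comment> \<open>The parallelogram identity, with \<open>bar p\<close> permuting the
    range.\<close>
  have s2: "(\<Sum>x\<in>{1..n}. (?d x)\<^sup>2) + (\<Sum>x\<in>{1..n}. (?s x)\<^sup>2) = 4 * ?S2"
  proof -
    have "(\<Sum>x\<in>{1..n}. (?d x)\<^sup>2) + (\<Sum>x\<in>{1..n}. (?s x)\<^sup>2)
        = (\<Sum>x\<in>{1..n}. 2 * (bar p x)\<^sup>2 + 2 * x\<^sup>2)"
      unfolding sum.distrib[symmetric]
      by (rule sum.cong) (auto simp: power2_eq_square algebra_simps)
    also have "\<dots> = 4 * ?S2"
      using bar_sum[of "\<lambda>x. x\<^sup>2"] by (simp add: sum.distrib flip: sum_distrib_left)
    finally show ?thesis .
  qed
  \<comment> \<open>Since \<open>?s x\<close> is at most \<open>2 * n = p - 1\<close>, the identity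
    for \<open>square_diff_tilde\<close> applies.\<close>
  have squares: "(\<Sum>x\<in>{1..n}. (?s x)\<^sup>2 - (?v x)\<^sup>2) = (\<Sum>x\<in>{1..n}. p * (?s x - ?v x))"
  proof (rule sum.cong[OF refl])
    fix x assume x: "x \<in> {1..n}"
    then have "bar p x \<in> {1..n}" using bij by (rule bij_betw_apply[rotated])
    then show "(?s x)\<^sup>2 - (?v x)\<^sup>2 = p * (?s x - ?v x)"
      using x p by (intro square_diff_tilde) (use p_form in auto)
  qed
  have "p * (\<Sum>x\<in>{1..n}. ?d x) = 2 * ?S2"
  proof -
    have "(\<Sum>x\<in>{1..n}. (?s x)\<^sup>2) - (\<Sum>x\<in>{1..n}. (?v x)\<^sup>2) = 2 * ?S2"
      using d2 s2 by linarith
    moreover have "(\<Sum>x\<in>{1..n}. ?s x) - (\<Sum>x\<in>{1..n}. ?v x) = (\<Sum>x\<in>{1..n}. ?d x)"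
      using d1 s1 by linarith
    ultimately show ?thesis
      using squares by (simp only: sum_subtractf sum_distrib_left[symmetric])
  qed
  moreover have "6 * ?S2 = p * (n * (n + 1))"
  proof -
    have "0 \<le> n" unfolding n_def by (rule p_form)
    from sum_squares_int_upto[OF this] show ?thesis unfolding p by (simp only: ac_simps)
  qed
  ultimately have "p * (3 * (\<Sum>x\<in>{1..n}. ?d x)) = p * (n * (n + 1))"
    by (simp only: mult.left_commute[of p 3])
  then show ?thesis using p_form(2) by simp
qed

end

section \<open>From the total chord length to the three counts\<close>

theorem theorem3p1:
  fixes p :: int
  assumes "prime p" and "[p = 1] (mod 4)"
  shows "real (card (Y_set p)) = L p \<and> real (card (X_set p)) + real (card (Z_set p)) = 2 * L p"
proof -
  define n where "n = (p - 1) div 2"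
  interpret fixpoint_free_involution n "bar p"
    unfolding n_def using assms by (rule bar_involution)
  have V: "V = V_set p" by (auto simp: V_def V_set_def bar_def simp flip: n_def)
  have XYZ: "X = X_set p" "Y = Y_set p" "Z = Z_set p"
    by (auto simp: V X_def X_set_def Y_def Y_set_def Z_def Z_set_def)
  have p: "real_of_int p = 2 * real_of_int n + 1"
    using p_form(5)[OF assms] unfolding n_def by linarith
  \<comment> \<open>With \<open>c\<close> chords, \<open>n = 2 * c\<close> and
    \<open>p = 4 * c + 1\<close>, so \<open>L p\<close> becomes
    \<open>c * (c - 1) / 6\<close>.\<close>
  define c where "c = real (card V)"
  have c: "real_of_int n = 2 * c" unfolding c_def using card_V by linarith
  have "12 * int (card X + card Z) = n * (n + 1) - 3 * n"
    using card_X_Z sum_length_bar[OF assms] by (simp add: n_def)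
  then have "real_of_int (12 * int (card X + card Z)) = real_of_int (n * (n + 1) - 3 * n)"
    by (rule arg_cong)
  then have XZ: "6 * (real (card X) + real (card Z)) = 2 * c * (c - 1)"
    using c by (simp add: algebra_simps)
  have "real (2 * (card X + card Y + card Z)) = real (card V * (card V - 1))"
    using card_pairs by (rule arg_cong)
  also have "\<dots> = c * (c - 1)"
    \<comment> \<open>The case \<open>card V = 0\<close> is separate because
      \<open>card V - 1\<close> is truncated there.\<close>
    unfolding c_def by (cases "card V") (auto simp: algebra_simps)
  finally have all: "2 * (real (card X) + real (card Y) + real (card Z)) = c * (c - 1)" by simp
  have L: "6 * L p = c * (c - 1)" by (simp add: L_def p c field_simps)
  \<comment> \<open>All pairs number \<open>3 * L p\<close> and those in \<open>X\<close> and
    \<open>Z\<close> number \<open>2 * L p\<close>, which leaves \<open>L p\<close> for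
    \<open>Y\<close>.\<close>
  show ?thesis using XZ all L unfolding XYZ by argo
qed

end
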